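(* Let $E=(x_E,y_E)\in\mathbb{R}^2$, let $\mathcal{D}(E)$ be the unit circle centered at $E$, and for $p\in\mathbb{R}\setminus\{0\}$ let $\mathcal{P}(p)$ be the parabola $y^2=2px+p^2$. Then $(\mathcal{D}(E),\mathcal{P}(p))$ is a $3$-Poncelet pair if and only if $x_E^2+y_E^2-1=0$.
   Context: Real conics are identified with their complexifications in $\mathbb{CP}^2$, and polygons are taken in $\mathbb{CP}^2$ (vertices and sides may be non-real). For $n\ge 3$ and two smooth conics $\mathcal{C}_1,\mathcal{C}_2$, an $n$-Poncelet polygon is an $n$-gon ($n$ distinct vertices, $n$ distinct side lines) whose vertices lie on $\mathcal{C}_1$ and whose side lines are tangent to $\mathcal{C}_2$; a $k$-gon traversed $m>1$ times is not regarded as an $mk$-gon. The pair $(\mathcal{C}_1,\mathcal{C}_2)$ is an $n$-Poncelet pair if such an $n$-gon exists. *)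

theory Defs
  imports "HOL-Analysis.Analysis"
begin

text \<open>
  The complex projective plane: nonzero vectors \<open>(x, y, z)\<close> up to nonzero scalars.
  The bilinear form \<^const>\<open>scalar_product\<close> is used throughout; the inner product on
  \<^typ>\<open>complex ^ 3\<close> is the real one and would be wrong here.
\<close>

definition proportional :: "complex ^ 3 \<Rightarrow> complex ^ 3 \<Rightarrow> bool" where
  "proportional v w \<longleftrightarrow> v \<noteq> 0 \<and> w \<noteq> 0 \<and> (\<exists>c. c \<noteq> 0 \<and> w = c *s v)"

lemma part_equivp_proportional: "part_equivp proportional"
proof (rule part_equivpI)
  have "(vector [1, 0, 0] :: complex ^ 3) \<noteq> 0"
    by (simp add: vec_eq_iff forall_3)
  then have "proportional (vector [1, 0, 0]) (vector [1, 0, 0])"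
    by (auto simp: proportional_def intro!: exI[of _ 1])
  then show "\<exists>v. proportional v v" ..
  show "symp proportional"
  proof (rule sympI)
    fix v w :: "complex ^ 3" assume "proportional v w"
    then obtain c where c: "v \<noteq> 0" "w \<noteq> 0" "c \<noteq> 0" "w = c *s v"
      by (auto simp: proportional_def)
    then have "v = inverse c *s w" by (simp add: vector_smult_assoc)
    with c(1-3) show "proportional w v"
      unfolding proportional_def by (intro conjI exI[of _ "inverse c"]) simp_all
  qed
  show "transp proportional"
  proof (rule transpI)
    fix u v w :: "complex ^ 3" assume "proportional u v" "proportional v w"
    then obtain c d where "u \<noteq> 0" "w \<noteq> 0" "c \<noteq> 0" "d \<noteq> 0" "w = (d * c) *s u"
      by (auto simp: proportional_def vector_smult_assoc)
    then show "proportional u w"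
      unfolding proportional_def by (intro conjI exI[of _ "d * c"]) simp_all
  qed
qed

quotient_type cp2 = "complex ^ 3" / partial: proportional
  by (rule part_equivp_proportional)

lemma scalar_product_smult:
  fixes a v :: "complex ^ 3"
  shows "scalar_product a (c *s v) = c * scalar_product a v"
    and "scalar_product (c *s a) v = c * scalar_product a v"
  by (simp_all add: scalar_product_def sum_distrib_left mult_ac)

lemma matrix_vector_mult_smult:
  fixes A :: "complex ^ 3 ^ 3"
  shows "A *v (c *s v) = c *s (A *v v)"
  by (simp add: matrix_vector_mult_def vec_eq_iff sum_distrib_left mult_ac)

lift_definition on_line :: "complex ^ 3 \<Rightarrow> cp2 \<Rightarrow> bool" is
  "\<lambda>a v. scalar_product a v = 0"
  by (auto simp: proportional_def scalar_product_smult)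

definition is_line :: "cp2 set \<Rightarrow> bool" where
  "is_line L \<longleftrightarrow> (\<exists>a. a \<noteq> 0 \<and> L = {P. on_line a P})"

text \<open>
  A conic is given by a symmetric matrix \<open>A\<close>, as the zero set of the quadratic form
  \<open>F(v) = v\<^sup>T A v\<close>. The gradient of \<open>F\<close> at \<open>v\<close> is \<open>2 A v\<close>, so \<open>v\<close> is a singular point
  iff \<open>A v = 0\<close>, and the tangent line at a smooth point \<open>v\<close> is \<open>{w. v\<^sup>T A w = 0}\<close>.
\<close>

lift_definition conjugate_pts :: "complex ^ 3 ^ 3 \<Rightarrow> cp2 \<Rightarrow> cp2 \<Rightarrow> bool" is
  "\<lambda>A v w. scalar_product v (A *v w) = 0"
  by (auto simp: proportional_def scalar_product_smult matrix_vector_mult_smult)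

lift_definition gradient_vanishes :: "complex ^ 3 ^ 3 \<Rightarrow> cp2 \<Rightarrow> bool" is
  "\<lambda>A v. A *v v = 0"
  by (auto simp: proportional_def matrix_vector_mult_smult)

definition conic_points :: "complex ^ 3 ^ 3 \<Rightarrow> cp2 set" where
  "conic_points A = {P. conjugate_pts A P P}"

definition smooth_conic :: "complex ^ 3 ^ 3 \<Rightarrow> bool" where
  "smooth_conic A \<longleftrightarrow> transpose A = A \<and> (\<forall>P\<in>conic_points A. \<not> gradient_vanishes A P)"

definition tangent_to :: "cp2 set \<Rightarrow> complex ^ 3 ^ 3 \<Rightarrow> bool" where
  "tangent_to L A \<longleftrightarrow>
     (\<exists>P\<in>conic_points A. \<not> gradient_vanishes A P \<and> L = {Q. conjugate_pts A P Q})"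

text \<open>
  Side \<open>S i\<close> joins vertex \<open>V i\<close> to the cyclically next one. Injectivity of \<open>V\<close> and \<open>S\<close>
  excludes multiply traversed polygons.
\<close>

definition is_polygon :: "nat \<Rightarrow> (nat \<Rightarrow> cp2) \<Rightarrow> (nat \<Rightarrow> cp2 set) \<Rightarrow> bool" where
  "is_polygon n V S \<longleftrightarrow>
     inj_on V {..<n} \<and> inj_on S {..<n} \<and>
     (\<forall>i<n. is_line (S i) \<and> V i \<in> S i \<and> V (Suc i mod n) \<in> S i)"

definition poncelet_polygon ::
  "nat \<Rightarrow> complex ^ 3 ^ 3 \<Rightarrow> complex ^ 3 ^ 3 \<Rightarrow> (nat \<Rightarrow> cp2) \<Rightarrow> (nat \<Rightarrow> cp2 set) \<Rightarrow> bool" where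
  "poncelet_polygon n C1 C2 V S \<longleftrightarrow>
     is_polygon n V S \<and> (\<forall>i<n. V i \<in> conic_points C1) \<and> (\<forall>i<n. tangent_to (S i) C2)"

definition poncelet_pair :: "nat \<Rightarrow> complex ^ 3 ^ 3 \<Rightarrow> complex ^ 3 ^ 3 \<Rightarrow> bool" where
  "poncelet_pair n C1 C2 \<longleftrightarrow>
     n \<ge> 3 \<and> smooth_conic C1 \<and> smooth_conic C2 \<and> (\<exists>V S. poncelet_polygon n C1 C2 V S)"

text \<open>
  The complexification of \<open>a x\<^sup>2 + b x y + c y\<^sup>2 + d x + e y + f = 0\<close>; the matrix is the Hessian
  of the homogenised polynomial, i.e. twice its Gram matrix.
\<close>

definition real_conic :: "real \<Rightarrow> real \<Rightarrow> real \<Rightarrow> real \<Rightarrow> real \<Rightarrow> real \<Rightarrow> complex ^ 3 ^ 3" where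
  "real_conic a b c d e f =
     vector [vector [of_real (2 * a), of_real b, of_real d],
             vector [of_real b, of_real (2 * c), of_real e],
             vector [of_real d, of_real e, of_real (2 * f)]]"

lift_definition affine_pt :: "complex \<Rightarrow> complex \<Rightarrow> cp2" is
  "\<lambda>x y. vector [x, y, 1]"
proof -
  fix x y :: complex
  have "(vector [x, y, 1] :: complex ^ 3) \<noteq> 0"
    by (simp add: vec_eq_iff forall_3)
  then show "proportional (vector [x, y, 1]) (vector [x, y, 1])"
    by (auto simp: proportional_def intro!: exI[of _ 1])
qed

lemma conjugate_pts_affine_pt:
  "conjugate_pts A (affine_pt x y) (affine_pt x' y') \<longleftrightarrow>
     scalar_product (vector [x, y, 1]) (A *v vector [x', y', 1]) = 0"
  by transfer (rule refl)

lemma affine_pt_in_real_conic: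
  "affine_pt x y \<in> conic_points (real_conic a b c d e f) \<longleftrightarrow>
     of_real a * x\<^sup>2 + of_real b * x * y + of_real c * y\<^sup>2
       + of_real d * x + of_real e * y + of_real f = 0" (is "_ \<longleftrightarrow> ?q = 0")
proof -
  have "scalar_product (vector [x, y, 1]) (real_conic a b c d e f *v vector [x, y, 1]) = 2 * ?q"
    by (simp add: scalar_product_def matrix_vector_mult_def sum_3 real_conic_def) algebra
  then show ?thesis
    unfolding conic_points_def mem_Collect_eq conjugate_pts_affine_pt
    by (metis mult_eq_0_iff zero_neq_numeral)
qed

definition unit_circle :: "real \<times> real \<Rightarrow> complex ^ 3 ^ 3" where
  "unit_circle E =
     real_conic 1 0 1 (- 2 * fst E) (- 2 * snd E) ((fst E)\<^sup>2 + (snd E)\<^sup>2 - 1)"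

definition parabola :: "real \<Rightarrow> complex ^ 3 ^ 3" where
  "parabola p = real_conic 0 0 1 (- 2 * p) 0 (- p\<^sup>2)"

lemma affine_pt_in_unit_circle:
  "affine_pt x y \<in> conic_points (unit_circle E) \<longleftrightarrow>
     (x - of_real (fst E))\<^sup>2 + (y - of_real (snd E))\<^sup>2 = 1"
proof -
  have "(x - of_real (fst E))\<^sup>2 + (y - of_real (snd E))\<^sup>2 = 1 \<longleftrightarrow>
        (x - of_real (fst E))\<^sup>2 + (y - of_real (snd E))\<^sup>2 - 1 = 0" by simp
  then show ?thesis
    unfolding unit_circle_def affine_pt_in_real_conic
    by (simp add: power2_eq_square algebra_simps)
qed

lemma real_points_unit_circle:
  "{(x, y). affine_pt (of_real x) (of_real y) \<in> conic_points (unit_circle E)} = sphere E 1"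
proof -
  have "affine_pt (of_real x) (of_real y) \<in> conic_points (unit_circle E) \<longleftrightarrow> (x, y) \<in> sphere E 1" for x y
  proof -
    have "affine_pt (of_real x) (of_real y) \<in> conic_points (unit_circle E) \<longleftrightarrow>
        complex_of_real ((x - fst E)\<^sup>2 + (y - snd E)\<^sup>2) = of_real 1"
      unfolding affine_pt_in_unit_circle by simp
    also have "\<dots> \<longleftrightarrow> (x - fst E)\<^sup>2 + (y - snd E)\<^sup>2 = 1"
      by (rule of_real_eq_iff)
    also have "\<dots> \<longleftrightarrow> (x, y) \<in> sphere E 1"
      by (cases E) (simp add: dist_prod_def dist_real_def power2_commute[of x] power2_commute[of y])
    finally show ?thesis .
  qed
  then show ?thesis by auto
qed

lemma affine_pt_in_parabola:
  "affine_pt x y \<in> conic_points (parabola p) \<longleftrightarrow> y\<^sup>2 = 2 * of_real p * x + (of_real p)\<^sup>2"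
proof -
  have "y\<^sup>2 = 2 * of_real p * x + (of_real p)\<^sup>2 \<longleftrightarrow>
        y\<^sup>2 - 2 * of_real p * x - (of_real p)\<^sup>2 = 0"
    by (simp add: diff_diff_eq)
  then show ?thesis
    unfolding parabola_def affine_pt_in_real_conic by simp
qed

end

theory Submission
  imports Defs
begin

text \<open>
  The parabola has its focus at the origin, so the right-hand side says that the circle passes
  through the focus. Its tangent lines are
  \<open>s\<^sup>2 x - s t y + (p/2) (s\<^sup>2 + t\<^sup>2) z = 0\<close> for \<open>(s, t) \<noteq> (0, 0)\<close>.
  If the vertices of a triangle cut out by three such lines lie on the circle, eliminating the
  parameters forces the constant term \<open>x\<^sub>E\<^sup>2 + y\<^sub>E\<^sup>2 - 1\<close> of the circle to vanish. Conversely, the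
  focus and the two circular points at infinity always form a triangle circumscribed about the
  parabola: its sides are the line at infinity and the two isotropic lines through the focus.
  The circular points lie on every circle, and the focus lies on this one by assumption.
\<close>

section \<open>Homogeneous coordinates\<close>

text \<open>The value at \<open>(0, 0, 0)\<close> carries no meaning, since the zero vector
  represents no point; hence the nonvanishing hypotheses on coordinates below.\<close>

definition hpt :: "complex \<Rightarrow> complex \<Rightarrow> complex \<Rightarrow> cp2" where
  "hpt x y z = abs_cp2 (vector [x, y, z])"

lemma vec3_eq_iff:
  fixes v w :: "complex ^ 3"
  shows "v = w \<longleftrightarrow> v $ 1 = w $ 1 \<and> v $ 2 = w $ 2 \<and> v $ 3 = w $ 3"
  by (simp add: vec_eq_iff forall_3)

lemma vector3_eq_0_iff:
  "(vector [x, y, z] :: complex ^ 3) = 0 \<longleftrightarrow> x = 0 \<and> y = 0 \<and> z = 0"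
  by (simp add: vec3_eq_iff)

lemma proportional_refl_iff: "proportional v v \<longleftrightarrow> v \<noteq> 0"
  by (auto simp: proportional_def intro!: exI[of _ 1])

lemma hpt_cases:
  obtains x y z where "P = hpt x y z" "x \<noteq> 0 \<or> y \<noteq> 0 \<or> z \<noteq> 0"
proof (induction P rule: cp2.abs_induct)
  case (1 v)
  have v: "v = vector [v $ 1, v $ 2, v $ 3]"
    by (simp add: vec3_eq_iff)
  have "v \<noteq> 0" using 1(1) by (simp add: proportional_refl_iff)
  then show ?case
    using 1(2)[of "v $ 1" "v $ 2" "v $ 3"] v
    unfolding hpt_def by (metis vector3_eq_0_iff)
qed

lemma on_line_hpt:
  assumes "x \<noteq> 0 \<or> y \<noteq> 0 \<or> z \<noteq> 0"
  shows "on_line (vector [a, b, c]) (hpt x y z) \<longleftrightarrow> a * x + b * y + c * z = 0"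
  using assms unfolding hpt_def
  by (subst on_line.abs_eq)
    (auto simp: proportional_refl_iff vector3_eq_0_iff scalar_product_def sum_3)

lemma conjugate_pts_hpt:
  assumes "x \<noteq> 0 \<or> y \<noteq> 0 \<or> z \<noteq> 0" "x' \<noteq> 0 \<or> y' \<noteq> 0 \<or> z' \<noteq> 0"
  shows "conjugate_pts A (hpt x y z) (hpt x' y' z') \<longleftrightarrow>
    scalar_product (vector [x, y, z]) (A *v vector [x', y', z']) = 0"
  using assms unfolding hpt_def
  by (subst conjugate_pts.abs_eq) (auto simp: proportional_refl_iff vector3_eq_0_iff)

lemma gradient_vanishes_hpt:
  assumes "x \<noteq> 0 \<or> y \<noteq> 0 \<or> z \<noteq> 0"
  shows "gradient_vanishes A (hpt x y z) \<longleftrightarrow> A *v vector [x, y, z] = 0"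
  using assms unfolding hpt_def
  by (subst gradient_vanishes.abs_eq) (auto simp: proportional_refl_iff vector3_eq_0_iff)

lemma transpose_real_conic: "transpose (real_conic a b c d e f) = real_conic a b c d e f"
  by (simp add: transpose_def real_conic_def vec_eq_iff forall_3)

section \<open>The circle and the parabola\<close>

lemma unit_circle_mult_vector:
  "unit_circle (a, b) *v vector [x, y, z] =
    vector [2 * (x - of_real a * z), 2 * (y - of_real b * z),
      2 * (of_real (a\<^sup>2 + b\<^sup>2 - 1) * z - of_real a * x - of_real b * y)]"
  by (simp add: vec3_eq_iff matrix_vector_mult_def sum_3 real_conic_def unit_circle_def
      algebra_simps)

lemma hpt_in_unit_circle:
  assumes "x \<noteq> 0 \<or> y \<noteq> 0 \<or> z \<noteq> 0"
  shows "hpt x y z \<in> conic_points (unit_circle (a, b)) \<longleftrightarrow>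
    x\<^sup>2 + y\<^sup>2 - 2 * of_real a * x * z - 2 * of_real b * y * z
      + of_real (a\<^sup>2 + b\<^sup>2 - 1) * z\<^sup>2 = 0" (is "_ \<longleftrightarrow> ?q = 0")
proof -
  have "scalar_product (vector [x, y, z]) (unit_circle (a, b) *v vector [x, y, z]) = 2 * ?q"
    by (simp add: unit_circle_mult_vector scalar_product_def sum_3 algebra_simps power2_eq_square)
  then show ?thesis
    by (simp only: conic_points_def mem_Collect_eq conjugate_pts_hpt[OF assms assms]
        mult_eq_0_iff zero_neq_numeral[symmetric] simp_thms)
qed

lemma smooth_unit_circle: "smooth_conic (unit_circle (a, b))"
  unfolding smooth_conic_def
proof (intro conjI ballI)
  show "transpose (unit_circle (a, b)) = unit_circle (a, b)"
    unfolding unit_circle_def by (rule transpose_real_conic)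
next
  fix P
  obtain x y z where P: "P = hpt x y z" and nz: "x \<noteq> 0 \<or> y \<noteq> 0 \<or> z \<noteq> 0"
    by (rule hpt_cases)
  have "x = 0 \<and> y = 0 \<and> z = 0"
    if "x - of_real a * z = 0" "y - of_real b * z = 0"
      and eq: "of_real (a\<^sup>2 + b\<^sup>2 - 1) * z - of_real a * x - of_real b * y = 0"
  proof -
    have xy: "x = of_real a * z" "y = of_real b * z" using that by simp_all
    \<comment> \<open>After substitution the terms in a^2 and b^2 cancel and - z = 0 remains, so the
      matrix has trivial kernel for every center.\<close>
    have "z = 0" using eq unfolding xy by (simp add: algebra_simps power2_eq_square)
    then show ?thesis using xy by simp
  qed
  then show "\<not> gradient_vanishes (unit_circle (a, b)) P"
    using nz unfolding P gradient_vanishes_hpt[OF nz] unit_circle_mult_vector vector3_eq_0_iff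
    by (simp only: mult_eq_0_iff zero_neq_numeral[symmetric] simp_thms) blast
qed

section \<open>The parabola: smoothness, rational parametrization, tangent lines\<close>

lemma parabola_mult_vector:
  "parabola p *v vector [x, y, z] =
    vector [- 2 * of_real p * z, 2 * y, - 2 * of_real p * (x + of_real p * z)]"
  by (simp add: vec3_eq_iff matrix_vector_mult_def sum_3 real_conic_def parabola_def
      power2_eq_square algebra_simps)

lemma not_gradient_vanishes_parabola:
  assumes "p \<noteq> 0"
  shows "\<not> gradient_vanishes (parabola p) P"
proof -
  obtain x y z where P: "P = hpt x y z" and nz: "x \<noteq> 0 \<or> y \<noteq> 0 \<or> z \<noteq> 0"
    by (rule hpt_cases)
  show ?thesis
    using assms nz by (auto simp: P gradient_vanishes_hpt parabola_mult_vector vector3_eq_0_iff)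
qed

lemma smooth_parabola: "p \<noteq> 0 \<Longrightarrow> smooth_conic (parabola p)"
  by (simp add: smooth_conic_def not_gradient_vanishes_parabola)
    (simp add: parabola_def transpose_real_conic)

lemma hpt_in_parabola:
  assumes "x \<noteq> 0 \<or> y \<noteq> 0 \<or> z \<noteq> 0"
  shows "hpt x y z \<in> conic_points (parabola p) \<longleftrightarrow>
    y\<^sup>2 = 2 * of_real p * x * z + (of_real p)\<^sup>2 * z\<^sup>2" (is "_ \<longleftrightarrow> ?l = ?r")
proof -
  have "scalar_product (vector [x, y, z]) (parabola p *v vector [x, y, z]) = 2 * (?l - ?r)"
    by (simp add: parabola_mult_vector scalar_product_def sum_3) algebra
  then show ?thesis
    by (simp only: conic_points_def mem_Collect_eq conjugate_pts_hpt[OF assms assms]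
        mult_eq_0_iff zero_neq_numeral[symmetric] simp_thms right_minus_eq)
qed

text \<open>The equation factors as y^2 = p z (2 x + p z), so \<open>s\<close> and \<open>t\<close>
  are square roots of z and (2 x + p z) / p, with signs matched by y = p s t.\<close>

lemma parabola_rational_parametrization:
  fixes p x y z :: complex
  assumes "p \<noteq> 0" "y\<^sup>2 = 2 * p * x * z + p\<^sup>2 * z\<^sup>2"
  obtains s t where "x = p * (t\<^sup>2 - s\<^sup>2) / 2" "y = p * s * t" "z = s\<^sup>2"
proof (cases "z = 0")
  case True
  with assms have "y = 0" by simp
  \<comment> \<open>With y = z = 0 the choice is s = 0 and t a square root of 2 x / p.\<close>
  then show ?thesis
    using True assms(1) that[of "csqrt (2 * x / p)" 0] by simp
next
  case False
  define s where "s = csqrt z"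
  have s: "s\<^sup>2 = z" "s \<noteq> 0" using False by (auto simp: s_def)
  define t where "t = y / (p * s)"
  have y: "y = p * s * t" using s assms(1) by (simp add: t_def)
  have "(p * s\<^sup>2) * (p * t\<^sup>2) = (p * s\<^sup>2) * (2 * x + p * s\<^sup>2)"
    using assms(2) unfolding y s(1)[symmetric] by (simp add: power2_eq_square algebra_simps)
  then have "p * t\<^sup>2 = 2 * x + p * s\<^sup>2" using s(2) assms(1) by simp
  then have "x = p * (t\<^sup>2 - s\<^sup>2) / 2" by (simp add: algebra_simps)
  then show ?thesis
    using that y s(1) by blast
qed

text \<open>The polar of the point with parameters \<open>(s, t)\<close>, divided by - 2 p. For s =
  0 it is the line at infinity; for s^2 + t^2 = 0 it is an isotropic line through the focus.\<close>

definition parabola_tangent :: "real \<Rightarrow> complex \<Rightarrow> complex \<Rightarrow> complex ^ 3" where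
  "parabola_tangent p s t = vector [s\<^sup>2, - (s * t), of_real p * (s\<^sup>2 + t\<^sup>2) / 2]"

lemma polar_eq_parabola_tangent:
  fixes p :: real and s t :: complex
  assumes "p \<noteq> 0" "s \<noteq> 0 \<or> t \<noteq> 0"
  shows "conjugate_pts (parabola p) (hpt (of_real p * (t\<^sup>2 - s\<^sup>2) / 2) (of_real p * s * t) (s\<^sup>2)) Q
    \<longleftrightarrow> on_line (parabola_tangent p s t) Q"
proof -
  obtain x y z where Q: "Q = hpt x y z" and nz: "x \<noteq> 0 \<or> y \<noteq> 0 \<or> z \<noteq> 0"
    by (rule hpt_cases)
  let ?x = "of_real p * (t\<^sup>2 - s\<^sup>2) / 2" and ?y = "of_real p * s * t"
  let ?l = "s\<^sup>2 * x + - (s * t) * y + of_real p * (s\<^sup>2 + t\<^sup>2) / 2 * z"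
  have nz': "?x \<noteq> 0 \<or> ?y \<noteq> 0 \<or> s\<^sup>2 \<noteq> 0" using assms by auto
  have "scalar_product (vector [?x, ?y, s\<^sup>2]) (parabola p *v vector [x, y, z])
      = - 2 * of_real p * ?l"
    by (simp add: parabola_mult_vector scalar_product_def sum_3 field_simps power2_eq_square)
  then show ?thesis
    using assms(1)
    by (simp only: Q conjugate_pts_hpt[OF nz' nz] parabola_tangent_def on_line_hpt[OF nz]) simp
qed

lemma tangent_to_parabola_iff:
  assumes "p \<noteq> 0"
  shows "tangent_to L (parabola p) \<longleftrightarrow>
    (\<exists>s t. (s \<noteq> 0 \<or> t \<noteq> 0) \<and> L = {Q. on_line (parabola_tangent p s t) Q})"
proof
  assume "tangent_to L (parabola p)"
  then obtain P where P: "P \<in> conic_points (parabola p)"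
    and L: "L = {Q. conjugate_pts (parabola p) P Q}"
    by (auto simp: tangent_to_def)
  obtain x y z where Pe: "P = hpt x y z" and nz: "x \<noteq> 0 \<or> y \<noteq> 0 \<or> z \<noteq> 0"
    by (rule hpt_cases)
  obtain s t where st: "x = of_real p * (t\<^sup>2 - s\<^sup>2) / 2" "y = of_real p * s * t" "z = s\<^sup>2"
  proof (rule parabola_rational_parametrization[of "of_real p" y x z])
    show "of_real p \<noteq> (0 :: complex)" using assms by simp
    show "y\<^sup>2 = 2 * of_real p * x * z + (of_real p)\<^sup>2 * z\<^sup>2"
      using P unfolding Pe hpt_in_parabola[OF nz] .
  qed
  with nz have "s \<noteq> 0 \<or> t \<noteq> 0" by auto
  then show "\<exists>s t. (s \<noteq> 0 \<or> t \<noteq> 0) \<and> L = {Q. on_line (parabola_tangent p s t) Q}"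
    using polar_eq_parabola_tangent[OF assms] unfolding L Pe st by blast
next
  assume "\<exists>s t. (s \<noteq> 0 \<or> t \<noteq> 0) \<and> L = {Q. on_line (parabola_tangent p s t) Q}"
  then obtain s t where st: "s \<noteq> 0 \<or> t \<noteq> 0"
    and L: "L = {Q. on_line (parabola_tangent p s t) Q}" by blast
  let ?P = "hpt (of_real p * (t\<^sup>2 - s\<^sup>2) / 2) (of_real p * s * t) (s\<^sup>2)"
  have "?P \<in> conic_points (parabola p)"
  proof (subst hpt_in_parabola)
    show "of_real p * (t\<^sup>2 - s\<^sup>2) / 2 \<noteq> 0 \<or> of_real p * s * t \<noteq> 0 \<or> s\<^sup>2 \<noteq> 0"
      using st assms by auto
    show "(of_real p * s * t)\<^sup>2 =
        2 * of_real p * (of_real p * (t\<^sup>2 - s\<^sup>2) / 2) * s\<^sup>2 + (of_real p)\<^sup>2 * (s\<^sup>2)\<^sup>2"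
      by (simp add: field_simps power2_eq_square)
  qed
  then show "tangent_to L (parabola p)"
    unfolding tangent_to_def L
    using polar_eq_parabola_tangent[OF assms st] not_gradient_vanishes_parabola[OF assms] by blast
qed

text \<open>Contrapositive: parameters proportional with factor c give coordinate vectors
  proportional with factor c^2, hence the same line.\<close>

lemma parabola_tangents_distinct:
  assumes "{Q. on_line (parabola_tangent p s t) Q} \<noteq> {Q. on_line (parabola_tangent p s' t') Q}"
    and "s \<noteq> 0 \<or> t \<noteq> 0" "s' \<noteq> 0 \<or> t' \<noteq> 0"
  shows "s * t' \<noteq> s' * t"
proof
  assume eq: "s * t' = s' * t"
  obtain c where c: "c \<noteq> 0" "s' = c * s" "t' = c * t"
  proof (cases "s = 0")
    case True
    then show ?thesis using that[of "t' / t"] eq assms(2,3) by auto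
  next
    case False
    then have "t' = s' / s * t" using eq by (simp add: field_simps)
    then show ?thesis using that[of "s' / s"] False assms(3) by auto
  qed
  have "parabola_tangent p s' t' = c\<^sup>2 *s parabola_tangent p s t"
    by (simp add: parabola_tangent_def vec3_eq_iff c algebra_simps power2_eq_square)
  then have "on_line (parabola_tangent p s' t') Q \<longleftrightarrow> on_line (parabola_tangent p s t) Q" for Q
    using c(1) by (simp only:) (transfer, simp add: scalar_product_smult)
  with assms(1) show False by simp
qed

section \<open>Circumscribed triangles\<close>

text \<open>
  The equation of the circle \<open>x\<^sup>2 + y\<^sup>2 - 2 a x z - 2 b y z + k z\<^sup>2 = 0\<close> at the intersection
  \<open>(p (t t' - s s') / 2, p (s t' + s' t) / 2, s s')\<close> of the tangents with parameters
  \<open>(s, t)\<close> and \<open>(s', t')\<close>.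
\<close>

definition circle_at_vertex ::
  "complex \<Rightarrow> complex \<Rightarrow> complex \<Rightarrow> complex \<Rightarrow> complex \<Rightarrow> complex \<Rightarrow> complex \<Rightarrow> complex \<Rightarrow> complex"
  where
  "circle_at_vertex p a b k s t s' t' = p\<^sup>2 / 4 * (s\<^sup>2 + t\<^sup>2) * (s'\<^sup>2 + t'\<^sup>2)
    - a * p * (t * t' - s * s') * (s * s') - b * p * (s * t' + s' * t) * (s * s')
    + k * (s * s')\<^sup>2"

section \<open>Intersection of two tangents and elimination of the parameters\<close>

lemma circle_at_vertex_commute:
  "circle_at_vertex p a b k s t s' t' = circle_at_vertex p a b k s' t' s t"
  by (simp add: circle_at_vertex_def mult_ac add_ac)

text \<open>Two distinct tangents meet in a single point (u : v : w), so (x, y, z) is proportional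
  to (u, v, w) and the equation of the circle carries over.\<close>

lemma tangent_intersection_on_circle:
  fixes p a b k s t s' t' x y z :: complex
  assumes "s * t' \<noteq> s' * t" and nz: "x \<noteq> 0 \<or> y \<noteq> 0 \<or> z \<noteq> 0"
    and l: "s\<^sup>2 * x + - (s * t) * y + p * (s\<^sup>2 + t\<^sup>2) / 2 * z = 0"
    and l': "s'\<^sup>2 * x + - (s' * t') * y + p * (s'\<^sup>2 + t'\<^sup>2) / 2 * z = 0"
    and circ: "x\<^sup>2 + y\<^sup>2 - 2 * a * x * z - 2 * b * y * z + k * z\<^sup>2 = 0"
  shows "circle_at_vertex p a b k s t s' t' = 0"
proof -
  define q where "q = p / 2"
  define u v w where "u = q * (t * t' - s * s')" and "v = q * (s * t' + s' * t)"
    and "w = s * s'"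
  have "p = 2 * q" by (simp add: q_def)
  then have f: "circle_at_vertex p a b k s t s' t'
      = u\<^sup>2 + v\<^sup>2 - 2 * a * u * w - 2 * b * v * w + k * w\<^sup>2"
    by (simp add: circle_at_vertex_def u_def v_def w_def algebra_simps power2_eq_square)
  have D: "s * t' - s' * t \<noteq> 0" using assms(1) by simp
  define e where "e = s\<^sup>2 * x - s * t * y + q * (s\<^sup>2 + t\<^sup>2) * z"
  define e' where "e' = s'\<^sup>2 * x - s' * t' * y + q * (s'\<^sup>2 + t'\<^sup>2) * z"
  have e: "e = 0" "e' = 0"
    using l l' by (simp_all add: e_def e'_def q_def)
  \<comment> \<open>Eliminating x, y and z in turn from the two line equations yields the 2x2 minors
    of (x, y, z) and (u, v, w), each times a nonzero determinant.\<close>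
  have "(s * t' - s' * t) * (w * y - v * z) = s'\<^sup>2 * e - s\<^sup>2 * e'"
    unfolding e_def e'_def v_def w_def by (simp add: algebra_simps power2_eq_square)
  then have wy: "w * y = v * z" using D e by simp
  have "(s * t' - s' * t) * (w * x - u * z) = s' * t' * e - s * t * e'"
    unfolding e_def e'_def u_def w_def by (simp add: algebra_simps power2_eq_square)
  then have wx: "w * x = u * z" using D e by simp
  have "(s * t' - s' * t) * (v * x - u * y) = q * ((s'\<^sup>2 + t'\<^sup>2) * e - (s\<^sup>2 + t\<^sup>2) * e')"
    unfolding e_def e'_def u_def v_def by (simp add: algebra_simps power2_eq_square)
  then have vx: "v * x = u * y" using D e by simp
  \<comment> \<open>Proportionality without division: the circle form is quadratic, so it scales by
    squares. It is applied with \<open>c\<close> equal to x, y and z, one of which is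
    nonzero.\<close>
  have scale: "c\<^sup>2 * circle_at_vertex p a b k s t s' t' = 0"
    if "u * c = d * x" "v * c = d * y" "w * c = d * z" for c d
  proof -
    have "c\<^sup>2 * circle_at_vertex p a b k s t s' t' = (u * c)\<^sup>2 + (v * c)\<^sup>2
        - 2 * a * (u * c) * (w * c) - 2 * b * (v * c) * (w * c) + k * (w * c)\<^sup>2"
      unfolding f by (simp add: algebra_simps power2_eq_square)
    also have "\<dots> = d\<^sup>2 * (x\<^sup>2 + y\<^sup>2 - 2 * a * x * z - 2 * b * y * z + k * z\<^sup>2)"
      unfolding that by (simp add: algebra_simps power2_eq_square)
    finally show ?thesis using circ by simp
  qed
  have "x\<^sup>2 * circle_at_vertex p a b k s t s' t' = 0"
    by (rule scale[of _ u]) (use wx vx in simp_all)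
  moreover have "y\<^sup>2 * circle_at_vertex p a b k s t s' t' = 0"
    by (rule scale[of _ v]) (use wy vx in simp_all)
  moreover have "z\<^sup>2 * circle_at_vertex p a b k s t s' t' = 0"
    by (rule scale[of _ w]) (use wx wy in simp_all)
  ultimately show ?thesis using nz by auto
qed

text \<open>The case without the line at infinity: \<open>f\<close> is
  \<open>circle_at_vertex\<close> with s = s' = 1. The three equations determine a p and b p in
  terms of the parameters, and what remains is k = 0.\<close>

lemma circumscribed_triangle_affine:
  fixes p a b k t1 t2 t3 :: complex
  defines "f \<equiv> \<lambda>t t'. p\<^sup>2 / 4 * (1 + t\<^sup>2) * (1 + t'\<^sup>2) - a * p * (t * t' - 1) - b * p * (t + t') + k"
  assumes d: "t1 \<noteq> t2" "t1 \<noteq> t3" "t2 \<noteq> t3"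
    and f12: "f t1 t2 = 0" and f13: "f t1 t3 = 0" and f23: "f t2 t3 = 0"
  shows "k = 0"
proof -
  define A \<alpha> \<beta> where "A = p\<^sup>2 / 4" and "\<alpha> = a * p" and "\<beta> = b * p"
  have f: "f t t' = A * (1 + t\<^sup>2) * (1 + t'\<^sup>2) - \<alpha> * (t * t' - 1) - \<beta> * (t + t') + k" for t t'
    by (simp add: f_def A_def \<alpha>_def \<beta>_def)
  \<comment> \<open>The divided difference of \<open>f t\<close> between \<open>t'\<close> and
    \<open>t''\<close>; it is linear in \<alpha> and \<beta> and free of k.\<close>
  define g where "g = (\<lambda>t t' t''. A * (1 + t\<^sup>2) * (t' + t'') - \<alpha> * t - \<beta>)"
  have "(t2 - t3) * g t1 t2 t3 = f t1 t2 - f t1 t3"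
    unfolding f g_def by (simp add: algebra_simps power2_eq_square)
  then have g1: "g t1 t2 t3 = 0" using d f12 f13 by simp
  have "(t1 - t3) * g t2 t1 t3 = f t1 t2 - f t2 t3"
    unfolding f g_def by (simp add: algebra_simps power2_eq_square)
  then have g2: "g t2 t1 t3 = 0" using d f12 f23 by simp
  have "(t1 - t2) * (\<alpha> - A * (t1 * t2 + t1 * t3 + t2 * t3 - 1)) = g t2 t1 t3 - g t1 t2 t3"
    unfolding g_def by (simp add: algebra_simps power2_eq_square)
  then have \<alpha>: "\<alpha> = A * (t1 * t2 + t1 * t3 + t2 * t3 - 1)" using d g1 g2 by simp
  have "\<beta> = A * (t1 + t2 + t3 - t1 * t2 * t3) - g t1 t2 t3"
    unfolding g_def \<alpha> by (simp add: algebra_simps power2_eq_square)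
  then have \<beta>: "\<beta> = A * (t1 + t2 + t3 - t1 * t2 * t3)" using g1 by simp
  \<comment> \<open>For these \<alpha> and \<beta> every other term of \<open>f t1 t2\<close>
    cancels identically.\<close>
  have "k = f t1 t2"
    unfolding f \<alpha> \<beta> by (simp add: algebra_simps power2_eq_square)
  then show "k = 0" using f12 by simp
qed

text \<open>Two distinct isotropic tangents meet at the focus, where both affine coordinates vanish
  and the circle equation reduces to its constant term.\<close>

lemma circumscribed_triangle_at_infinity:
  fixes p a b k s t s' t' :: complex
  assumes d: "s * t' \<noteq> s' * t" and nz: "s \<noteq> 0" "s' \<noteq> 0"
    and iso: "s\<^sup>2 + t\<^sup>2 = 0" "s'\<^sup>2 + t'\<^sup>2 = 0"
    and f: "circle_at_vertex p a b k s t s' t' = 0"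
  shows "k = 0"
proof -
  have "(s * t' - s' * t) * (s * t' + s' * t) = s\<^sup>2 * (s'\<^sup>2 + t'\<^sup>2) - s'\<^sup>2 * (s\<^sup>2 + t\<^sup>2)"
    by (simp add: algebra_simps power2_eq_square)
  then have 1: "s * t' + s' * t = 0" using d iso by simp
  have "s * (t * t' - s * s') = t * (s * t' + s' * t) - s' * (s\<^sup>2 + t\<^sup>2)"
    by (simp add: algebra_simps power2_eq_square)
  then have "t * t' - s * s' = 0" using 1 iso nz by simp
  then have "k * (s * s')\<^sup>2 = 0" using f iso 1 by (simp add: circle_at_vertex_def)
  then show ?thesis using nz by simp
qed

lemma circumscribed_triangle:
  fixes p a b k s1 t1 s2 t2 s3 t3 :: complex
  assumes p: "p \<noteq> 0"
    and d: "s1 * t2 \<noteq> s2 * t1" "s1 * t3 \<noteq> s3 * t1" "s2 * t3 \<noteq> s3 * t2"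
    and f12: "circle_at_vertex p a b k s1 t1 s2 t2 = 0"
    and f13: "circle_at_vertex p a b k s1 t1 s3 t3 = 0"
    and f23: "circle_at_vertex p a b k s2 t2 s3 t3 = 0"
  shows "k = 0"
proof -
  let ?f = "circle_at_vertex p a b k"
  \<comment> \<open>If the first side is the line at infinity, each of its vertices gives p^2 / 4 *
    y1^2 * (x^2 + y^2) = 0 for the parameters (x, y) of the other side there, so both other sides
    are isotropic.\<close>
  have inf: "k = 0"
    if 0: "x1 = 0" and D: "x1 * y2 \<noteq> x2 * y1" "x1 * y3 \<noteq> x3 * y1" "x2 * y3 \<noteq> x3 * y2"
      and F: "?f x1 y1 x2 y2 = 0" "?f x1 y1 x3 y3 = 0" "?f x2 y2 x3 y3 = 0"
    for x1 y1 x2 y2 x3 y3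
  proof (rule circumscribed_triangle_at_infinity[OF D(3) _ _ _ _ F(3)])
    show "x2 \<noteq> 0" "x3 \<noteq> 0" using 0 D by auto
    show "x2\<^sup>2 + y2\<^sup>2 = 0" "x3\<^sup>2 + y3\<^sup>2 = 0"
      using 0 D(1,2) F(1,2) p by (auto simp: circle_at_vertex_def)
  qed
  consider "s1 = 0" | "s2 = 0" | "s3 = 0" | "s1 \<noteq> 0" "s2 \<noteq> 0" "s3 \<noteq> 0" by blast
  then show ?thesis
  proof cases
    case 1
    show ?thesis by (rule inf[OF 1 d f12 f13 f23])
  next
    case 2
    show ?thesis
      by (rule inf[OF 2 d(1)[symmetric] d(3,2)
            f12[unfolded circle_at_vertex_commute[of _ _ _ _ s1]] f23 f13])
  next
    case 3
    show ?thesis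
      by (rule inf[OF 3 d(2,3)[symmetric] d(1)
            f13[unfolded circle_at_vertex_commute[of _ _ _ _ s1]]
            f23[unfolded circle_at_vertex_commute[of _ _ _ _ s2]] f12])
  next
    case 4
    \<comment> \<open>\<open>circle_at_vertex\<close> is quadratic in each parameter pair, so
      division by (s s')^2 leaves the affine form in the ratios t / s.\<close>
    have scale: "p\<^sup>2 / 4 * (1 + (t / s)\<^sup>2) * (1 + (t' / s')\<^sup>2)
        - a * p * (t / s * (t' / s') - 1) - b * p * (t / s + t' / s') + k = 0"
      if nz: "s \<noteq> 0" "s' \<noteq> 0" and f0: "?f s t s' t' = 0" for s t s' t'
    proof -
      define r r' where "r = t / s" and "r' = t' / s'"
      have t: "t = r * s" "t' = r' * s'" using nz by (simp_all add: r_def r'_def)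
      have "?f s t s' t' = (s * s')\<^sup>2 * (p\<^sup>2 / 4 * (1 + r\<^sup>2) * (1 + r'\<^sup>2)
          - a * p * (r * r' - 1) - b * p * (r + r') + k)"
        unfolding circle_at_vertex_def t by (simp add: field_simps power2_eq_square)
      then show ?thesis using f0 nz by (simp add: r_def r'_def)
    qed
    show ?thesis
    proof (rule circumscribed_triangle_affine[of "t1 / s1" "t2 / s2" "t3 / s3" p a b])
      show "t1 / s1 \<noteq> t2 / s2" "t1 / s1 \<noteq> t3 / s3" "t2 / s2 \<noteq> t3 / s3"
        using d 4 by (auto simp: field_simps)
    qed (simp_all only: scale 4 f12 f13 f23 not_False_eq_True)
  qed
qed

section \<open>The two implications for Poncelet triangles\<close>

lemma poncelet_triangle_imp_focus_on_circle:
  assumes p: "p \<noteq> 0" and poly: "poncelet_polygon 3 (unit_circle (a, b)) (parabola p) V S"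
  shows "a\<^sup>2 + b\<^sup>2 - 1 = 0"
proof -
  have inj: "inj_on S {..<3}"
    and V: "\<And>i. i < 3 \<Longrightarrow> V i \<in> S i" "\<And>i. i < 3 \<Longrightarrow> V (Suc i mod 3) \<in> S i"
    and circ: "\<And>i. i < 3 \<Longrightarrow> V i \<in> conic_points (unit_circle (a, b))"
    and tan: "\<And>i. i < 3 \<Longrightarrow> tangent_to (S i) (parabola p)"
    using poly by (auto simp: poncelet_polygon_def is_polygon_def)
  have "\<forall>i. \<exists>s t. i < 3 \<longrightarrow>
      (s \<noteq> 0 \<or> t \<noteq> 0) \<and> S i = {Q. on_line (parabola_tangent p s t) Q}"
    using tan by (simp add: tangent_to_parabola_iff[OF p])
  then obtain s t where st: "\<And>i. i < 3 \<Longrightarrow> s i \<noteq> 0 \<or> t i \<noteq> 0"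
    and S: "\<And>i. i < 3 \<Longrightarrow> S i = {Q. on_line (parabola_tangent p (s i) (t i)) Q}"
    by metis
  have d: "s i * t j \<noteq> s j * t i" if "i < 3" "j < 3" "i \<noteq> j" for i j
    using parabola_tangents_distinct[of p "s i" "t i" "s j" "t j"] st that S
      inj_onD[OF inj, of i j] by auto
  let ?f = "circle_at_vertex (of_real p) (of_real a) (of_real b) (of_real (a\<^sup>2 + b\<^sup>2 - 1))"
  have f: "?f (s i) (t i) (s j) (t j) = 0"
    if "i < 3" "j < 3" "i \<noteq> j" "k < 3" "V k \<in> S i" "V k \<in> S j" for i j k
  proof -
    obtain x y z where P: "V k = hpt x y z" and nz: "x \<noteq> 0 \<or> y \<noteq> 0 \<or> z \<noteq> 0"
      by (rule hpt_cases)
    show ?thesis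
    proof (rule tangent_intersection_on_circle[OF _ nz])
      show "s i * t j \<noteq> s j * t i" using d that by blast
    qed (use that circ[of k] S[of i] S[of j] in
        \<open>simp_all only: mem_Collect_eq P hpt_in_unit_circle[OF nz] on_line_hpt[OF nz]
          parabola_tangent_def\<close>)
  qed
  have "of_real (a\<^sup>2 + b\<^sup>2 - 1) = (0 :: complex)"
  proof (rule circumscribed_triangle[of "of_real p" "s 0" "t 1" "s 1" "t 0" "t 2" "s 2"])
    \<comment> \<open>Side i joins vertices i and i + 1 modulo 3: sides 0 and 1 share vertex 1,
      sides 0 and 2 share vertex 0, sides 1 and 2 share vertex 2.\<close>
    show "?f (s 0) (t 0) (s 1) (t 1) = 0" by (rule f[of _ _ 1]) (use V(1)[of 1] V(2)[of 0] in auto)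
    show "?f (s 0) (t 0) (s 2) (t 2) = 0" by (rule f[of _ _ 0]) (use V(1)[of 0] V(2)[of 2] in auto)
    show "?f (s 1) (t 1) (s 2) (t 2) = 0"
      by (rule f[of _ _ 2]) (use V(1)[of 2] V(2)[of 1] in \<open>auto simp: numeral_2_eq_2\<close>)
  qed (use d p in auto)
  then show ?thesis by (simp only: of_real_eq_0_iff)
qed

lemma focus_on_circle_imp_poncelet_triangle:
  assumes p: "p \<noteq> 0" and foc: "a\<^sup>2 + b\<^sup>2 - 1 = 0"
  shows "\<exists>V S. poncelet_polygon 3 (unit_circle (a, b)) (parabola p) V S"
proof -
  define V where "V i = [hpt 0 0 1, hpt 1 \<i> 0, hpt 1 (- \<i>) 0] ! i" for i
  \<comment> \<open>In cyclic order: the isotropic line x + i y = 0, the line at infinity, and the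
    isotropic line x - i y = 0.\<close>
  define \<sigma> \<tau> :: "nat \<Rightarrow> complex" where "\<sigma> i = [1, 0, 1] ! i" and "\<tau> i = [- \<i>, 1, \<i>] ! i" for i
  define S where "S i = {Q. on_line (parabola_tangent p (\<sigma> i) (\<tau> i)) Q}" for i
  have all3: "(\<forall>i<3. R i) \<longleftrightarrow> R 0 \<and> R 1 \<and> R 2" for R :: "nat \<Rightarrow> bool"
    by (auto simp: numeral_3_eq_3 numeral_2_eq_2 less_Suc_eq)
  have mem: "hpt x y z \<in> S i \<longleftrightarrow>
      (\<sigma> i)\<^sup>2 * x + - (\<sigma> i * \<tau> i) * y + of_real p * ((\<sigma> i)\<^sup>2 + (\<tau> i)\<^sup>2) / 2 * z = 0"
    if "x \<noteq> 0 \<or> y \<noteq> 0 \<or> z \<noteq> 0" for x y z i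
    unfolding S_def parabola_tangent_def by (simp only: mem_Collect_eq on_line_hpt[OF that])
  note defs = \<sigma>_def \<tau>_def V_def
  have inc: "\<forall>i<3. V i \<in> S i" "\<forall>i<3. V (Suc i mod 3) \<in> S i"
    unfolding all3 by (simp_all add: defs mem)
  have opp: "V 2 \<notin> S 0" "V 0 \<notin> S 1" "V 1 \<notin> S 2"
    using p by (simp_all add: defs mem)
  have in3: "{..<3} = {0, 1, 2 :: nat}"
    by (simp add: numeral_3_eq_3 numeral_2_eq_2 lessThan_Suc insert_commute)
  have inc': "V 0 \<in> S 0" "V 1 \<in> S 0" "V 1 \<in> S 1" "V 2 \<in> S 1" "V 2 \<in> S 2" "V 0 \<in> S 2"
    using inc by (simp_all add: all3 numeral_2_eq_2[symmetric])
  text \<open>Each side contains exactly two of the three vertices, and the omitted vertices differ;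
    hence vertices and sides are distinct.\<close>
  have "inj_on V {..<3}" "inj_on S {..<3}"
    unfolding in3 using inc' opp by (auto simp: inj_on_def)
  moreover have nz: "\<sigma> i \<noteq> 0 \<or> \<tau> i \<noteq> 0" if "i < 3" for i
  proof -
    have "\<forall>i<3. \<sigma> i \<noteq> 0 \<or> \<tau> i \<noteq> 0" unfolding all3 by (simp add: defs)
    then show ?thesis using that by blast
  qed
  moreover have "is_line (S i)" if "i < 3" for i
    using nz[OF that] p unfolding is_line_def S_def
    by (intro exI[of _ "parabola_tangent p (\<sigma> i) (\<tau> i)"])
      (auto simp: parabola_tangent_def vector3_eq_0_iff)
  moreover have "\<forall>i<3. V i \<in> conic_points (unit_circle (a, b))"
    unfolding all3 using foc by (simp add: defs hpt_in_unit_circle)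
  moreover have "tangent_to (S i) (parabola p)" if "i < 3" for i
    using nz[OF that] tangent_to_parabola_iff[OF p] unfolding S_def by blast
  ultimately show ?thesis
    using inc unfolding poncelet_polygon_def is_polygon_def by blast
qed

theorem proposition3p1:
  fixes xE yE p :: real
  assumes "p \<noteq> 0"
  shows "poncelet_pair 3 (unit_circle (xE, yE)) (parabola p) \<longleftrightarrow> xE\<^sup>2 + yE\<^sup>2 - 1 = 0"
  using poncelet_triangle_imp_focus_on_circle[OF assms]
    focus_on_circle_imp_poncelet_triangle[OF assms]
    smooth_unit_circle smooth_parabola[OF assms]
  by (auto simp only: poncelet_pair_def order_refl)

end
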